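(* Let $(X,E)$ and $(Y,F)$ be digraphs. Then $(X\times Y,c_{E\times F})=(X\times Y,c_E\times c_F)$; that is, the Alexandroff closure of the digraph product equals the product closure of the Alexandroff closures of the two digraphs.
   Context: A (Čech) closure space $(X,c)$ is a set $X$ with a function $c:2^X\to 2^X$ such that $c(\varnothing)=\varnothing$, $A\subset c(A)$, and $c(A\cup B)=c(A)\cup c(B)$. A set $U$ is a neighborhood of $x$ if $x\notin c(X\setminus U)$. The product closure on $X\times Y$ is $(c_X\times c_Y)(A)=\{(x,y)\mid (U\times V)\cap A\neq\varnothing$ for all neighborhoods $U$ of $x$ and $V$ of $y\}$. A (simple) digraph $(X,E)$ is a set $X$ with a relation $E\subset X\times X$ disjoint from the diagonal $\Delta$; $\overline E=E\cup\Delta$. Sets of vertices and edges may have arbitrary cardinality. The associated closure is $c_E(A)=\{y\in X\mid\exists x\in A,\ x\overline Ey\}$. The digraph product of $(X,E)$ and $(Y,F)$ is the digraph $(X\times Y,E\times F)$ with $(x,y)\,\overline{E\times F}\,(x',y')$ if and only if $x\overline Ex'$ and $y\overline Fy'$. *)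

theory Defs
  imports "HOL-Library.FuncSet" "Graph_Theory.Pair_Digraph"
begin

text \<open>
  Functions \<open>2\<^sup>X \<rightarrow> 2\<^sup>X\<close> are elements of \<^term>\<open>Pow X \<rightarrow>\<^sub>E Pow X\<close>, i.e. they take the value
  \<^term>\<open>undefined\<close> outside \<^term>\<open>Pow X\<close>. Hence HOL equality of two closures on the same set
  \<open>X\<close> is exactly agreement on all subsets of \<open>X\<close>.
\<close>

definition closure_space :: "'a set \<Rightarrow> ('a set \<Rightarrow> 'a set) \<Rightarrow> bool" where
  "closure_space X c \<longleftrightarrow>
     c \<in> Pow X \<rightarrow>\<^sub>E Pow X \<and>
     c {} = {} \<and>
     (\<forall>A\<subseteq>X. A \<subseteq> c A) \<and>
     (\<forall>A\<subseteq>X. \<forall>B\<subseteq>X. c (A \<union> B) = c A \<union> c B)"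

definition nbhd :: "'a set \<Rightarrow> ('a set \<Rightarrow> 'a set) \<Rightarrow> 'a \<Rightarrow> 'a set \<Rightarrow> bool" where
  "nbhd X c x U \<longleftrightarrow> U \<subseteq> X \<and> x \<notin> c (X - U)"

definition prod_closure ::
  "'a set \<Rightarrow> ('a set \<Rightarrow> 'a set) \<Rightarrow> 'b set \<Rightarrow> ('b set \<Rightarrow> 'b set) \<Rightarrow> ('a \<times> 'b) set \<Rightarrow> ('a \<times> 'b) set" where
  "prod_closure X c Y d =
     (\<lambda>A\<in>Pow (X \<times> Y). {(x, y) \<in> X \<times> Y.
        \<forall>U V. nbhd X c x U \<longrightarrow> nbhd Y d y V \<longrightarrow> (U \<times> V) \<inter> A \<noteq> {}})"

text \<open>
  A simple digraph \<open>(X, E)\<close> is a \<^locale>\<open>pair_loopfree_digraph\<close> with \<open>pverts\<close> \<open>X\<close> and \<open>parcs\<close> \<open>E\<close>;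
  that locale imposes no finiteness.
\<close>

definition refl_arcs :: "'a pair_pre_digraph \<Rightarrow> ('a \<times> 'a) set" where
  "refl_arcs G = parcs G \<union> Id_on (pverts G)"

definition digraph_closure :: "'a pair_pre_digraph \<Rightarrow> 'a set \<Rightarrow> 'a set" where
  "digraph_closure G =
     (\<lambda>A\<in>Pow (pverts G). {y \<in> pverts G. \<exists>x\<in>A. (x, y) \<in> refl_arcs G})"

text \<open>
  The arc set of the digraph product is obtained by removing the diagonal from the prescribed
  reflexive relation; see \<open>refl_arcs_digraph_prod\<close> below.
\<close>

definition digraph_prod ::
  "'a pair_pre_digraph \<Rightarrow> 'b pair_pre_digraph \<Rightarrow> ('a \<times> 'b) pair_pre_digraph" where
  "digraph_prod G H =
     \<lparr> pverts = pverts G \<times> pverts H,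
       parcs = {((x, y), (x', y')) | x y x' y'.
         (x, x') \<in> refl_arcs G \<and> (y, y') \<in> refl_arcs H} - Id \<rparr>"

lemma refl_arcs_digraph_prod:
  assumes "pair_wf_digraph G" "pair_wf_digraph H"
  shows "((x, y), (x', y')) \<in> refl_arcs (digraph_prod G H) \<longleftrightarrow>
     (x, x') \<in> refl_arcs G \<and> (y, y') \<in> refl_arcs H"
  using pair_wf_digraph.in_arcsD1[OF assms(1)] pair_wf_digraph.in_arcsD1[OF assms(2)]
  unfolding digraph_prod_def refl_arcs_def by auto

lemma pair_loopfree_digraph_digraph_prod:
  assumes "pair_wf_digraph G" "pair_wf_digraph H"
  shows "pair_loopfree_digraph (digraph_prod G H)"
  by unfold_locales
    (use pair_wf_digraph.in_arcsD1[OF assms(1)] pair_wf_digraph.in_arcsD1[OF assms(2)]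
         pair_wf_digraph.in_arcsD2[OF assms(1)] pair_wf_digraph.in_arcsD2[OF assms(2)]
      in \<open>auto simp: digraph_prod_def refl_arcs_def\<close>)

lemma closure_space_digraph_closure: "closure_space (pverts G) (digraph_closure G)"
proof -
  have "digraph_closure G \<in> Pow (pverts G) \<rightarrow>\<^sub>E Pow (pverts G)"
    unfolding digraph_closure_def by auto
  moreover have "A \<subseteq> digraph_closure G A" if "A \<subseteq> pverts G" for A
    using that unfolding digraph_closure_def refl_arcs_def by auto
  moreover have "digraph_closure G (A \<union> B) = digraph_closure G A \<union> digraph_closure G B"
    if "A \<subseteq> pverts G" "B \<subseteq> pverts G" for A B
    using that unfolding digraph_closure_def by auto
  moreover have "digraph_closure G {} = {}"
    unfolding digraph_closure_def by simp
  ultimately show ?thesis by (simp add: closure_space_def)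
qed

lemma nbhd_Int:
  assumes "closure_space X c" "nbhd X c x U" "nbhd X c x V"
  shows "nbhd X c x (U \<inter> V)"
proof -
  have "c (X - U \<inter> V) = c (X - U) \<union> c (X - V)"
    using assms(1) by (simp add: closure_space_def Diff_Int)
  then show ?thesis using assms(2,3) by (auto simp: nbhd_def)
qed

lemma closure_space_prod_closure:
  assumes c: "closure_space X c" and d: "closure_space Y d"
  shows "closure_space (X \<times> Y) (prod_closure X c Y d)"
proof -
  let ?p = "prod_closure X c Y d"
  have nX: "nbhd X c x X" for x using c unfolding closure_space_def nbhd_def by simp
  have nY: "nbhd Y d y Y" for y using d unfolding closure_space_def nbhd_def by simp
  have memX: "x \<in> U" if "nbhd X c x U" "x \<in> X" for x U
  proof -
    have "X - U \<subseteq> c (X - U)" using c by (simp add: closure_space_def)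
    then show ?thesis using that by (auto simp: nbhd_def)
  qed
  have memY: "y \<in> V" if "nbhd Y d y V" "y \<in> Y" for y V
  proof -
    have "Y - V \<subseteq> d (Y - V)" using d by (simp add: closure_space_def)
    then show ?thesis using that by (auto simp: nbhd_def)
  qed
  have "?p \<in> Pow (X \<times> Y) \<rightarrow>\<^sub>E Pow (X \<times> Y)"
    unfolding prod_closure_def by auto
  moreover have "?p {} = {}"
    using nX nY unfolding prod_closure_def by auto
  moreover have "A \<subseteq> ?p A" if "A \<subseteq> X \<times> Y" for A
  proof
    fix z assume z: "z \<in> A"
    obtain x y where xy: "z = (x, y)" by (cases z)
    have "x \<in> X" "y \<in> Y" using z that xy by auto
    then have "(x, y) \<in> U \<times> V" if "nbhd X c x U" "nbhd Y d y V" for U V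
      using memX memY that by blast
    then have "(U \<times> V) \<inter> A \<noteq> {}" if "nbhd X c x U" "nbhd Y d y V" for U V
      using that z unfolding xy by blast
    then show "z \<in> ?p A" using that \<open>x \<in> X\<close> \<open>y \<in> Y\<close> unfolding xy prod_closure_def by auto
  qed
  moreover have "?p (A \<union> B) = ?p A \<union> ?p B" if A: "A \<subseteq> X \<times> Y" and B: "B \<subseteq> X \<times> Y" for A B
  proof
    show "?p A \<union> ?p B \<subseteq> ?p (A \<union> B)"
      using A B unfolding prod_closure_def by (auto simp: Int_Un_distrib)
    show "?p (A \<union> B) \<subseteq> ?p A \<union> ?p B"
    proof
      fix z assume z: "z \<in> ?p (A \<union> B)"
      obtain x y where xy: "z = (x, y)" by (cases z)
      have mem: "x \<in> X" "y \<in> Y"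
        and h: "\<And>U V. nbhd X c x U \<Longrightarrow> nbhd Y d y V \<Longrightarrow> (U \<times> V) \<inter> (A \<union> B) \<noteq> {}"
        using z A B unfolding xy prod_closure_def by auto
      show "z \<in> ?p A \<union> ?p B"
      proof (rule ccontr)
        assume n: "z \<notin> ?p A \<union> ?p B"
        obtain U V where 1: "nbhd X c x U" "nbhd Y d y V" "(U \<times> V) \<inter> A = {}"
          using n mem A unfolding xy prod_closure_def by auto
        obtain U' V' where 2: "nbhd X c x U'" "nbhd Y d y V'" "(U' \<times> V') \<inter> B = {}"
          using n mem B unfolding xy prod_closure_def by auto
        have "((U \<inter> U') \<times> (V \<inter> V')) \<inter> (A \<union> B) \<noteq> {}"
          by (rule h[OF nbhd_Int[OF c 1(1) 2(1)] nbhd_Int[OF d 1(2) 2(2)]])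
        then show False using 1(3) 2(3) by blast
      qed
    qed
  qed
  ultimately show ?thesis by (simp add: closure_space_def)
qed

end

theory Submission
  imports Defs
begin

text \<open>
  A vertex has a least neighborhood in the closure of a digraph, namely its set of predecessors in
  the reflexive relation. The product of the least neighborhoods of \<open>x\<close> and \<open>y\<close> decides membership
  of \<open>(x, y)\<close> in the product closure, and it is the set of predecessors of \<open>(x, y)\<close> in the digraph
  product.
\<close>

lemma refl_arcs_subset:
  assumes "pair_wf_digraph G"
  shows "refl_arcs G \<subseteq> pverts G \<times> pverts G"
  using pair_wf_digraph.in_arcsD1[OF assms] pair_wf_digraph.in_arcsD2[OF assms]
  unfolding refl_arcs_def by auto

text \<open>The vertex \<open>x\<close> escapes the closure of \<open>pverts G - U\<close> iff none
  of its reflexive predecessors lies there; by well-formedness they all lie in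
  \<open>pverts G\<close>, hence in \<open>U\<close>.\<close>

lemma nbhd_digraph_closure_iff:
  assumes "pair_wf_digraph G" "x \<in> pverts G"
  shows "nbhd (pverts G) (digraph_closure G) x U \<longleftrightarrow>
    U \<subseteq> pverts G \<and> (refl_arcs G)\<inverse> `` {x} \<subseteq> U"
  using refl_arcs_subset[OF assms(1)] assms(2)
  unfolding nbhd_def digraph_closure_def by auto

lemma prod_closure_digraph_closure:
  assumes "pair_wf_digraph G" "pair_wf_digraph H" "A \<subseteq> pverts G \<times> pverts H"
  shows "prod_closure (pverts G) (digraph_closure G) (pverts H) (digraph_closure H) A =
    {(x, y) \<in> pverts G \<times> pverts H.
      ((refl_arcs G)\<inverse> `` {x} \<times> (refl_arcs H)\<inverse> `` {y}) \<inter> A \<noteq> {}}"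
proof -
  have "(\<forall>U V. nbhd (pverts G) (digraph_closure G) x U \<longrightarrow>
           nbhd (pverts H) (digraph_closure H) y V \<longrightarrow> (U \<times> V) \<inter> A \<noteq> {}) \<longleftrightarrow>
        ((refl_arcs G)\<inverse> `` {x} \<times> (refl_arcs H)\<inverse> `` {y}) \<inter> A \<noteq> {}"
    if "x \<in> pverts G" "y \<in> pverts H" for x y
  proof -
    \<comment> \<open>Left to right, instantiate \<open>U\<close> and \<open>V\<close> with the
      predecessor sets. Conversely, every \<open>U \<times> V\<close> contains their product, so it
      meets \<open>A\<close> if that product does.\<close>
    have "nbhd (pverts G) (digraph_closure G) x ((refl_arcs G)\<inverse> `` {x})"
      "nbhd (pverts H) (digraph_closure H) y ((refl_arcs H)\<inverse> `` {y})"
      using refl_arcs_subset assms(1,2) that by (auto simp: nbhd_digraph_closure_iff)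
    moreover have "(refl_arcs G)\<inverse> `` {x} \<subseteq> U" "(refl_arcs H)\<inverse> `` {y} \<subseteq> V"
      if "nbhd (pverts G) (digraph_closure G) x U" "nbhd (pverts H) (digraph_closure H) y V" for U V
      using that assms(1,2) \<open>x \<in> pverts G\<close> \<open>y \<in> pverts H\<close>
      by (simp_all add: nbhd_digraph_closure_iff)
    ultimately show ?thesis by (smt (verit) Int_mono Sigma_mono order_refl subset_empty)
  qed
  then show ?thesis using assms(3) unfolding prod_closure_def by auto
qed

theorem proposition2p5:
  fixes G :: "'a pair_pre_digraph" and H :: "'b pair_pre_digraph"
  assumes "pair_loopfree_digraph G" and "pair_loopfree_digraph H"
  shows "(pverts (digraph_prod G H), digraph_closure (digraph_prod G H)) =
         (pverts G \<times> pverts H,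
          prod_closure (pverts G) (digraph_closure G) (pverts H) (digraph_closure H))"
proof -
  have wf: "pair_wf_digraph G" "pair_wf_digraph H"
    using assms by (simp_all add: pair_loopfree_digraph_def)
  have verts: "pverts (digraph_prod G H) = pverts G \<times> pverts H"
    by (simp add: digraph_prod_def)
  have "digraph_closure (digraph_prod G H) A =
      prod_closure (pverts G) (digraph_closure G) (pverts H) (digraph_closure H) A" for A
  proof (cases "A \<subseteq> pverts G \<times> pverts H")
    case True
    then have "digraph_closure (digraph_prod G H) A = {(x, y) \<in> pverts G \<times> pverts H.
        \<exists>x' y'. (x', y') \<in> A \<and> (x', x) \<in> refl_arcs G \<and> (y', y) \<in> refl_arcs H}"
      unfolding digraph_closure_def
      by (auto simp: verts Bex_def split_paired_Ex refl_arcs_digraph_prod[OF wf]) blast+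
    \<comment> \<open>The pair \<open>(x', y')\<close> is exactly a point of \<open>A\<close> in the
      product of the predecessor sets.\<close>
    also have "\<dots> = prod_closure (pverts G) (digraph_closure G) (pverts H) (digraph_closure H) A"
      unfolding prod_closure_digraph_closure[OF wf True] by blast
    finally show ?thesis .
  next
    case False
    \<comment> \<open>Outside the power set of the vertex set both restricted functions return
      \<open>undefined\<close>, so they agree as HOL functions.\<close>
    then show ?thesis
      by (simp add: digraph_closure_def prod_closure_def verts)
  qed
  with verts show ?thesis by auto
qed

end
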